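(* Let $t_0<\tau_0\le+\infty$ and let $a,b,c,d$ and $a_k,b_k,c_k,d_k$ ($k=1,2$) be real-valued continuous functions on $[t_0,\tau_0)$. For $k=1,2$ let $y_k(t)$ be a solution on $[t_0,\tau_0)$ of $$y'+a_k(t)y^3+b_k(t)y^2+c_k(t)y+d_k(t)=0,$$ such that $y_1(t_0)\le y_2(t_0)$. Assume: (I) $a(t)<0$ almost everywhere on $[t_0,\tau_0)$ and the function $\frac{b^2(t)}{a(t)}$ is locally integrable on $[t_0,\tau_0)$; (II) for some $\gamma_1\in[y_1(t_0),y_2(t_0)]$, $$\gamma_1-y_1(t_0)+\int_{t_0}^{t}\exp\Big\{\int_{t_0}^{\tau}\Big[c(s)-\frac{b^2(s)}{a(s)}\Big]ds\Big\}\Big[(a_1(\tau)-a(\tau))y_1^3(\tau)+(b_1(\tau)-b(\tau))y_1^2(\tau)+(c_1(\tau)-c(\tau))y_1(\tau)+d_1(\tau)-d(\tau)\Big]d\tau\ge 0$$ for all $t\in[t_0,\tau_0)$; (III) for some $\gamma_2\in[\gamma_1,y_2(t_0)]$, $$\gamma_2-y_2(t_0)+\int_{t_0}^{t}\exp\Big\{\int_{t_0}^{\tau}\Big[c(s)-\frac{b^2(s)}{a(s)}\Big]ds\Big\}\Big[(a_2(\tau)-a(\tau))y_2^3(\tau)+(b_2(\tau)-b(\tau))y_2^2(\tau)+(c_2(\tau)-c(\tau))y_2(\tau)+d_2(\tau)-d(\tau)\Big]d\tau\le 0$$ for all $t\in[t_0,\tau_0)$. Then every solution $y(t)$ of $$y'+a(t)y^3+b(t)y^2+c(t)y+d(t)=0$$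 with $y(t_0)\in[\gamma_1,\gamma_2]$ exists on $[t_0,\tau_0)$ and $$y_1(t)\le y(t)\le y_2(t),\qquad t_0\le t<\tau_0.$$ Furthermore, if $y_1(t_0)<y(t_0)$, then $y_1(t)<y(t)$ for all $t\in[t_0,\tau_0)$; and if $y(t_0)<y_2(t_0)$, then $y(t)<y_2(t)$ for all $t\in[t_0,\tau_0)$.
   Context: All functions are real-valued. A solution of a differential equation on an interval is a differentiable function satisfying it at every point of the interval (one-sided derivative at an included endpoint). "A solution $y$ of the equation exists on $[t_0,\tau_0)$" means that the solution of the initial value problem with the given value at $t_0$ is defined on all of $[t_0,\tau_0)$. "Locally integrable on $[t_0,\tau_0)$" means Lebesgue integrable on $[t_0,t_1]$ for every $t_1\in(t_0,\tau_0)$. *)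

theory Defs
  imports "HOL-Analysis.Analysis"
begin

text \<open>The right endpoint is an extended real, so that the interval may be unbounded.\<close>

definition half_open :: "real \<Rightarrow> ereal \<Rightarrow> real set" where
  "half_open t0 \<tau>0 = {t. t0 \<le> t \<and> ereal t < \<tau>0}"

text \<open>The derivative is taken within the interval, hence one-sided at an endpoint that
  belongs to it. Values of the functions outside the interval are irrelevant.\<close>

definition abel_solution ::
  "(real \<Rightarrow> real) \<Rightarrow> (real \<Rightarrow> real) \<Rightarrow> (real \<Rightarrow> real) \<Rightarrow> (real \<Rightarrow> real) \<Rightarrow>
    real set \<Rightarrow> (real \<Rightarrow> real) \<Rightarrow> bool" where
  "abel_solution a b c d I y \<longleftrightarrow>
    (\<exists>y'. \<forall>t\<in>I. (y has_real_derivative y' t) (at t within I) \<and>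
      y' t + a t * y t ^ 3 + b t * y t ^ 2 + c t * y t + d t = 0)"

text \<open>The solution with value \<open>y0\<close> at \<open>t0\<close> is defined on all of \<open>I\<close>: there is a solution on
  \<open>I\<close> with that initial value, and every solution with that initial value on a smaller interval
  starting at \<open>t0\<close> is the restriction of a solution on \<open>I\<close> (so no solution breaks down
  before the end of \<open>I\<close>).\<close>

definition abel_exists_on ::
  "(real \<Rightarrow> real) \<Rightarrow> (real \<Rightarrow> real) \<Rightarrow> (real \<Rightarrow> real) \<Rightarrow> (real \<Rightarrow> real) \<Rightarrow>
    real set \<Rightarrow> real \<Rightarrow> real \<Rightarrow> bool" where
  "abel_exists_on a b c d I t0 y0 \<longleftrightarrow>
    (\<exists>y. abel_solution a b c d I y \<and> y t0 = y0) \<and>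
    (\<forall>J z. is_interval J \<and> t0 \<in> J \<and> J \<subseteq> I \<and> abel_solution a b c d J z \<and> z t0 = y0 \<longrightarrow>
      (\<exists>y. abel_solution a b c d I y \<and> (\<forall>t\<in>J. y t = z t)))"

end

theory Submission
  imports Defs
begin

text \<open>Write \<open>x\<close>, \<open>z\<close> for two functions to be compared, one solving the given equation and the other
  one of the bounds \<open>y1\<close>, \<open>y2\<close>. Their difference \<open>u = x - z\<close> satisfies the linear equation
  \<open>u' = F - u * (a * (x\<^sup>2 + x * z + z\<^sup>2) + b * (x + z) + c)\<close>, where \<open>F\<close> collects the differences of
  the coefficients. The bracket is \<open>c - b\<^sup>2 / a\<close> minus the function
  \<open>k = - (a * (x\<^sup>2 + x * z + z\<^sup>2) + b * (x + z) + b\<^sup>2 / a)\<close>, and \<open>k = - a * Q\<close> for a quadratic form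
  \<open>Q\<close> in \<open>x\<close>, \<open>z\<close>, \<open>b / a\<close> that is positive definite (\<open>cubic_quotient_form_nonneg\<close>). Hence \<open>k\<close> is
  nonnegative wherever \<open>a < 0\<close>, and positive there if moreover \<open>x \<noteq> z\<close>.

  With the integrating factor \<open>E = exp (\<integral> c - b\<^sup>2 / a)\<close>, the function \<open>v = E * u\<close> satisfies
  \<open>v t = (u t0 + \<integral> E * F) + \<integral> k * v\<close> (\<open>integrating_factor_integral\<close>). The bracketed part is
  nonnegative: this is what the integral hypotheses on the two bounds say, given that the initial
  value lies between \<open>\<gamma>1\<close> and \<open>\<gamma>2\<close>. So \<open>v\<close> dominates a Volterra integral of
  itself with a nonnegative kernel, which forces \<open>v \<ge> 0\<close> (\<open>volterra_nonneg\<close>), and \<open>v > 0\<close> if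
  \<open>v\<close> is initially positive (\<open>volterra_pos\<close>).

  The same comparison, applied to two solutions of one equation with a common initial value, gives
  uniqueness. Existence follows because every solution, on whatever initial segment it lives, is
  confined between \<open>y1\<close> and \<open>y2\<close> and therefore cannot blow up: truncating the cubic outside a
  large band makes it globally Lipschitz, so that the truncated equation has a solution on each
  compact interval \<open>{t0..T}\<close> (\<open>lipschitz_ode_solution\<close>), and this solution never reaches
  the edge of the band (\<open>abel_solution_exists_of_bound\<close>). By uniqueness these solutions fit
  together, and every solution on a smaller interval is a restriction of the result.\<close>

section \<open>Integrating factors with integrable exponents\<close>

lemma absolutely_integrable_mult_continuous:
  fixes f g :: "real \<Rightarrow> real"
  assumes "continuous_on {s..t} f" and "g absolutely_integrable_on {s..t}"
  shows "(\<lambda>x. f x * g x) absolutely_integrable_on {s..t}"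
proof (rule absolutely_integrable_bounded_measurable_product_real)
  show "f \<in> borel_measurable (lebesgue_on {s..t})"
    using assms(1) by (rule continuous_imp_measurable_on_sets_lebesgue) simp
  show "bounded (f ` {s..t})"
    using assms(1) by (intro compact_imp_bounded compact_continuous_image) auto
qed (use assms in auto)

lemma absolutely_integral_combine:
  fixes f :: "real \<Rightarrow> real"
  assumes "f absolutely_integrable_on {a..c}" and "a \<le> b" and "b \<le> c"
  shows "(LINT x:{a..c}|lebesgue. f x) = (LINT x:{a..b}|lebesgue. f x) + (LINT x:{b..c}|lebesgue. f x)"
proof -
  have "f absolutely_integrable_on {a..b}" "f absolutely_integrable_on {b..c}"
    by (rule absolutely_integrable_on_subinterval[OF assms(1)]; use assms in simp)+
  then show ?thesis
    using Henstock_Kurzweil_Integration.integral_combine[of a b c f] assms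
    by (simp add: set_lebesgue_integral_eq_integral)
qed

lemma continuous_on_indefinite_absolutely_integral:
  fixes f :: "real \<Rightarrow> real"
  assumes "f absolutely_integrable_on {s..T}"
  shows "continuous_on {s..T} (\<lambda>x. LINT r:{s..x}|lebesgue. f r)"
proof -
  have eq: "(LINT r:{s..x}|lebesgue. f r) = integral {s..x} f" if "x \<in> {s..T}" for x
    using assms that
    by (intro set_lebesgue_integral_eq_integral absolutely_integrable_on_subinterval[OF assms]) auto
  have "continuous_on {s..T} (\<lambda>x. integral {s..x} f)"
    using assms by (intro indefinite_integral_continuous_1 set_lebesgue_integral_eq_integral)
  then show ?thesis
    by (rule continuous_on_eq) (simp add: eq)
qed

lemma absolutely_integral_dominated_convergence:
  fixes f :: "real \<Rightarrow> real" and F :: "nat \<Rightarrow> real \<Rightarrow> real"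
  assumes "f absolutely_integrable_on S" and "\<And>n. F n absolutely_integrable_on S"
    and "w absolutely_integrable_on S"
    and "AE x in lebesgue. x \<in> S \<longrightarrow> (\<lambda>n. F n x) \<longlonglongrightarrow> f x"
    and "\<And>n. AE x in lebesgue. x \<in> S \<longrightarrow> \<bar>F n x\<bar> \<le> w x"
  shows "(\<lambda>n. LINT x:S|lebesgue. F n x) \<longlonglongrightarrow> (LINT x:S|lebesgue. f x)"
  unfolding set_lebesgue_integral_def
proof (rule integral_dominated_convergence)
  show "integrable lebesgue (\<lambda>x. indicator S x *\<^sub>R w x)"
    using assms(3) by (simp add: set_integrable_def)
  show "(\<lambda>x. indicat_real S x *\<^sub>R f x) \<in> borel_measurable lebesgue"
    using assms(1) by (auto simp: set_integrable_def)
  show "(\<lambda>x. indicat_real S x *\<^sub>R F n x) \<in> borel_measurable lebesgue" for n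
    using assms(2)[of n] by (auto simp: set_integrable_def)
  show "AE x in lebesgue. (\<lambda>n. indicat_real S x *\<^sub>R F n x) \<longlonglongrightarrow> indicat_real S x *\<^sub>R f x"
    using assms(4) by eventually_elim (auto simp: indicator_def)
  show "AE x in lebesgue. norm (indicat_real S x *\<^sub>R F n x) \<le> indicat_real S x *\<^sub>R w x" for n
    using assms(5)[of n] by eventually_elim (auto simp: indicator_def)
qed

text \<open>This is the integrated form of \<open>(E * u)' = E * (u' + p * u)\<close> for the integrating factor of a
  merely integrable \<open>p\<close>, where \<open>E\<close> need not be differentiable at every point. The
  classical product rule and the fundamental theorem of calculus apply to the integrating factors of
  continuous approximations of \<open>p\<close>, and dominated convergence passes to the limit.\<close>

lemma integrating_factor_integral:
  fixes p q u g :: "real \<Rightarrow> real" and P :: "nat \<Rightarrow> real \<Rightarrow> real"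
  assumes P: "\<And>n. continuous_on {s..T} (P n)"
    and lim: "AE x in lebesgue. x \<in> {s..T} \<longrightarrow> (\<lambda>n. P n x) \<longlonglongrightarrow> p x"
    and dom: "\<And>n. AE x in lebesgue. x \<in> {s..T} \<longrightarrow> \<bar>P n x\<bar> \<le> q x"
    and p: "p absolutely_integrable_on {s..T}" and q: "q absolutely_integrable_on {s..T}"
    and u: "\<And>x. x \<in> {s..T} \<Longrightarrow> (u has_real_derivative g x) (at x within {s..T})"
    and g: "continuous_on {s..T} g" and t: "t \<in> {s..T}"
  defines "E \<equiv> \<lambda>x. exp (LINT r:{s..x}|lebesgue. p r)"
  shows "E t * u t = u s + (LINT x:{s..t}|lebesgue. E x * (g x + p x * u x))"
proof -
  define En where "En n x = exp (integral {s..x} (P n))" for n x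
  define C where "C = exp (LINT r:{s..T}|lebesgue. q r)"
  have sub: "{s..x} \<subseteq> {s..T}" if "x \<in> {s..T}" for x
    using that by auto
  have pS: "p absolutely_integrable_on {s..x}" and qS: "q absolutely_integrable_on {s..x}"
    if "x \<in> {s..T}" for x
    by (rule absolutely_integrable_on_subinterval[OF p sub[OF that]]
        absolutely_integrable_on_subinterval[OF q sub[OF that]])+
  have contS: "continuous_on {s..x} (P n)" if "x \<in> {s..T}" for x n
    using P sub[OF that] by (rule continuous_on_subset)
  have PS: "P n absolutely_integrable_on {s..x}" if "x \<in> {s..T}" for x n
    using contS[OF that] by (rule absolutely_integrable_continuous_real)
  have uc: "continuous_on {s..T} u"
    using u by (meson DERIV_continuous continuous_on_eq_continuous_within)
  have En_lim: "(\<lambda>n. En n x) \<longlonglongrightarrow> E x" if x: "x \<in> {s..T}" for x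
  proof -
    have "(\<lambda>n. LINT r:{s..x}|lebesgue. P n r) \<longlonglongrightarrow> (LINT r:{s..x}|lebesgue. p r)"
    proof (rule absolutely_integral_dominated_convergence[OF pS[OF x] PS[OF x] qS[OF x]])
      show "AE r in lebesgue. r \<in> {s..x} \<longrightarrow> (\<lambda>n. P n r) \<longlonglongrightarrow> p r"
        using lim by eventually_elim (use x in auto)
      show "AE r in lebesgue. r \<in> {s..x} \<longrightarrow> \<bar>P n r\<bar> \<le> q r" for n
        using dom[of n] by eventually_elim (use x in auto)
    qed
    moreover have "(LINT r:{s..x}|lebesgue. P n r) = integral {s..x} (P n)" for n
      by (rule set_lebesgue_integral_eq_integral(2)[OF PS[OF x]])
    ultimately show ?thesis
      unfolding En_def E_def by (intro tendsto_exp) simp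
  qed
  have En_deriv: "(En n has_real_derivative En n x * P n x) (at x within {s..T})"
    if "x \<in> {s..T}" for n x
    unfolding En_def
    by (rule derivative_eq_intros integral_has_real_derivative P that refl)+
  have Ec: "continuous_on {s..T} E"
    unfolding E_def
    by (intro continuous_intros continuous_on_indefinite_absolutely_integral p)
  have Enc: "continuous_on {s..T} (En n)" for n
    using En_deriv by (meson DERIV_continuous continuous_on_eq_continuous_within)
  have q0: "AE x in lebesgue. x \<in> {s..T} \<longrightarrow> 0 \<le> q x"
    using dom[of 0] by eventually_elim force
  have En_bound: "En n x \<le> C" if x: "x \<in> {s..T}" for n x
  proof -
    have "integral {s..x} (P n) = (LINT r:{s..x}|lebesgue. P n r)"
      by (rule set_lebesgue_integral_eq_integral(2)[OF PS[OF x], symmetric])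
    also have "\<dots> \<le> (LINT r:{s..x}|lebesgue. q r)"
    proof (rule set_integral_mono_AE[OF PS[OF x] qS[OF x]])
      show "AE r\<in>{s..x} in lebesgue. P n r \<le> q r"
        using dom[of n] by eventually_elim (use x in auto)
    qed
    also have "\<dots> \<le> (LINT r:{s..x}|lebesgue. q r) + (LINT r:{x..T}|lebesgue. q r)"
    proof -
      have "(LINT r:{x..T}|lebesgue. 0) \<le> (LINT r:{x..T}|lebesgue. q r)"
      proof (rule set_integral_mono_AE)
        show "AE r\<in>{x..T} in lebesgue. 0 \<le> q r"
          using q0 by eventually_elim (use x in auto)
        show "q absolutely_integrable_on {x..T}"
          using x by (intro absolutely_integrable_on_subinterval[OF q]) auto
      qed (simp add: set_integrable_def)
      then show ?thesis by simp
    qed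
    also have "\<dots> = (LINT r:{s..T}|lebesgue. q r)"
      using x by (intro absolutely_integral_combine[OF q, symmetric]) auto
    finally show ?thesis
      by (simp add: En_def C_def)
  qed
  have gc: "continuous_on {s..t} g" and uct: "continuous_on {s..t} u"
    and Ect: "continuous_on {s..t} E" and Enct: "continuous_on {s..t} (En n)" for n
    by (rule continuous_on_subset[OF _ sub[OF t]], rule g uc Ec Enc)+
  have gt: "g absolutely_integrable_on {s..t}"
    by (rule absolutely_integrable_continuous_real[OF gc])
  have FTC: "En n t * u t - u s = (LINT x:{s..t}|lebesgue. En n x * (g x + P n x * u x))" for n
  proof -
    have "((\<lambda>x. En n x * (g x + P n x * u x)) has_integral (En n t * u t - En n s * u s)) {s..t}"
    proof (rule fundamental_theorem_of_calculus)
      fix x assume x: "x \<in> {s..t}"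
      then have xT: "x \<in> {s..T}"
        using t by auto
      have "((\<lambda>x. En n x * u x) has_real_derivative En n x * g x + En n x * P n x * u x) (at x within {s..T})"
        by (rule DERIV_mult'[OF En_deriv[OF xT] u[OF xT]])
      then have "((\<lambda>x. En n x * u x) has_real_derivative En n x * (g x + P n x * u x)) (at x within {s..t})"
        using sub[OF t] by (auto intro: DERIV_subset simp: algebra_simps)
      then show "((\<lambda>x. En n x * u x) has_vector_derivative En n x * (g x + P n x * u x)) (at x within {s..t})"
        by (simp add: has_real_derivative_iff_has_vector_derivative)
    qed (use t in auto)
    moreover have "(\<lambda>x. En n x * (g x + P n x * u x)) absolutely_integrable_on {s..t}"
      by (intro absolutely_integrable_continuous_real continuous_intros Enct gc uct contS t)
    moreover have "En n s = 1"
      by (simp add: En_def)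
    ultimately show ?thesis
      by (simp add: set_lebesgue_integral_eq_integral integral_unique)
  qed
  have "(\<lambda>n. LINT x:{s..t}|lebesgue. En n x * (g x + P n x * u x))
      \<longlonglongrightarrow> (LINT x:{s..t}|lebesgue. E x * (g x + p x * u x))"
  proof (rule absolutely_integral_dominated_convergence[where w = "\<lambda>x. C * (\<bar>g x\<bar> + \<bar>u x\<bar> * q x)"])
    have pu: "(\<lambda>x. p x * u x) absolutely_integrable_on {s..t}"
      using absolutely_integrable_mult_continuous[OF uct pS[OF t]] by (simp add: mult.commute)
    show "(\<lambda>x. E x * (g x + p x * u x)) absolutely_integrable_on {s..t}"
      by (rule absolutely_integrable_mult_continuous[OF Ect set_integral_add(1)[OF gt pu]])
    show "(\<lambda>x. En n x * (g x + P n x * u x)) absolutely_integrable_on {s..t}" for n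
      by (intro absolutely_integrable_continuous_real continuous_intros Enct gc uct contS t)
    show "(\<lambda>x. C * (\<bar>g x\<bar> + \<bar>u x\<bar> * q x)) absolutely_integrable_on {s..t}"
      by (intro set_integrable_mult_right set_integral_add set_integrable_abs gt
          absolutely_integrable_mult_continuous qS t continuous_intros uct)
    show "AE x in lebesgue. x \<in> {s..t} \<longrightarrow>
        (\<lambda>n. En n x * (g x + P n x * u x)) \<longlonglongrightarrow> E x * (g x + p x * u x)"
      using lim
    proof eventually_elim
      case (elim x)
      then show ?case
        using t by (auto intro!: tendsto_intros En_lim)
    qed
    show "AE x in lebesgue. x \<in> {s..t} \<longrightarrow> \<bar>En n x * (g x + P n x * u x)\<bar> \<le> C * (\<bar>g x\<bar> + \<bar>u x\<bar> * q x)" for n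
      using dom[of n]
    proof eventually_elim
      case (elim x)
      show ?case
      proof
        assume x: "x \<in> {s..t}"
        then have P_le: "\<bar>P n x\<bar> \<le> q x" and E_le: "En n x \<le> C" and E_pos: "0 \<le> En n x"
          using elim t En_bound by (auto simp: En_def)
        have "\<bar>g x + P n x * u x\<bar> \<le> \<bar>g x\<bar> + \<bar>P n x\<bar> * \<bar>u x\<bar>"
          by (metis abs_mult abs_triangle_ineq)
        also have "\<dots> \<le> \<bar>g x\<bar> + \<bar>u x\<bar> * q x"
          using mult_right_mono[OF P_le, of "\<bar>u x\<bar>"] by (simp add: mult.commute)
        finally show "\<bar>En n x * (g x + P n x * u x)\<bar> \<le> C * (\<bar>g x\<bar> + \<bar>u x\<bar> * q x)"
          using E_le E_pos by (simp add: abs_mult mult_mono)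
      qed
    qed
  qed
  moreover have "(\<lambda>n. En n t * u t - u s) \<longlonglongrightarrow> E t * u t - u s"
    by (intro tendsto_intros En_lim t)
  ultimately have "E t * u t - u s = (LINT x:{s..t}|lebesgue. E x * (g x + p x * u x))"
    unfolding FTC by (rule LIMSEQ_unique[rotated])
  then show ?thesis
    by simp
qed

section \<open>Volterra inequalities with a nonnegative kernel\<close>

text \<open>If \<open>v\<close> became negative, it would do so for the first time after some point \<open>r\<close>. On an interval to
  the right of \<open>r\<close> so short that the integral of \<open>k\<close> over it is less than \<open>1\<close>, the negative minimum
  of \<open>v\<close> would have to be at least its own product with a number smaller than \<open>1\<close>.\<close>

lemma volterra_nonneg:
  fixes v k :: "real \<Rightarrow> real"
  assumes v: "continuous_on {s..T} v" and k: "k absolutely_integrable_on {s..T}"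
    and k0: "AE x in lebesgue. x \<in> {s..T} \<longrightarrow> 0 \<le> k x"
    and ge: "\<And>t. t \<in> {s..T} \<Longrightarrow> (LINT x:{s..t}|lebesgue. k x * v x) \<le> v t"
    and t: "t \<in> {s..T}"
  shows "0 \<le> v t"
proof (rule ccontr)
  assume "\<not> 0 \<le> v t"
  define A where "A = {x \<in> {s..T}. v x < 0}"
  define r where "r = Inf A"
  have "t \<in> A"
    using \<open>\<not> 0 \<le> v t\<close> t by (auto simp: A_def)
  have bdd: "bdd_below A"
    by (auto simp: A_def bdd_below_def)
  have rs: "s \<le> r"
    unfolding r_def using \<open>t \<in> A\<close> by (intro cInf_greatest) (auto simp: A_def)
  have rt: "r \<le> t"
    unfolding r_def using \<open>t \<in> A\<close> bdd by (rule cInf_lower)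
  have below: "0 \<le> v x" if "x \<in> {s..<r}" for x
  proof (rule ccontr)
    assume "\<not> 0 \<le> v x"
    then have "x \<in> A"
      using that rt t by (auto simp: A_def)
    then have "r \<le> x"
      unfolding r_def using bdd by (rule cInf_lower)
    then show False
      using that by simp
  qed
  define K where "K x = (LINT y:{s..x}|lebesgue. k y)" for x
  have "continuous_on {s..T} K"
    unfolding K_def by (rule continuous_on_indefinite_absolutely_integral[OF k])
  then obtain \<delta> where \<delta>: "\<delta> > 0" "\<And>x. x \<in> {s..T} \<Longrightarrow> dist x r < \<delta> \<Longrightarrow> dist (K x) (K r) < 1"
    using rs rt t unfolding continuous_on_iff
    by (metis atLeastAtMost_iff dual_order.trans zero_less_one)
  obtain t' where t': "t' \<in> A" "t' < r + \<delta>"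
    using cInf_lessD[of A "r + \<delta>"] \<open>t \<in> A\<close> \<delta>(1) unfolding r_def by auto
  have rt': "r \<le> t'"
    unfolding r_def using t'(1) bdd by (rule cInf_lower)
  have "continuous_on {r..t'} v"
    using t'(1) rs by (intro continuous_on_subset[OF v]) (auto simp: A_def)
  then obtain m where m: "m \<in> {r..t'}" "\<And>x. x \<in> {r..t'} \<Longrightarrow> v m \<le> v x"
    using continuous_attains_inf[of "{r..t'}" v] rt' by auto
  have vm: "v m < 0"
    using m(2)[of t'] rt' t'(1) by (auto simp: A_def)
  have mT: "m \<in> {s..T}"
    using m(1) rs t'(1) by (auto simp: A_def)
  have kv: "(\<lambda>x. k x * v x) absolutely_integrable_on {s..m}"
  proof -
    have "(\<lambda>x. v x * k x) absolutely_integrable_on {s..T}"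
      by (rule absolutely_integrable_mult_continuous[OF v k])
    then have "(\<lambda>x. k x * v x) absolutely_integrable_on {s..T}"
      by (simp add: mult.commute)
    then show ?thesis
      by (rule absolutely_integrable_on_subinterval) (use mT in auto)
  qed
  have km: "k absolutely_integrable_on {s..m}" and krm: "k absolutely_integrable_on {r..m}"
    using mT rs by (auto intro!: absolutely_integrable_on_subinterval[OF k])
  \<comment> \<open>The integrand is nonnegative before \<open>r\<close>; discarding the null set \<open>{r}\<close> avoids having to
    determine the sign of \<open>v r\<close>.\<close>
  have "AE x in lebesgue. x \<noteq> r"
    by (intro AE_completion AE_lborel_singleton)
  then have "(LINT x:{s..r}|lebesgue. 0) \<le> (LINT x:{s..r}|lebesgue. k x * v x)"
  proof (intro set_integral_mono_AE)
    show "(\<lambda>x. k x * v x) absolutely_integrable_on {s..r}"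
      using m by (intro absolutely_integrable_on_subinterval[OF kv]) auto
    assume "AE x in lebesgue. x \<noteq> r"
    then show "AE x\<in>{s..r} in lebesgue. 0 \<le> k x * v x"
      using k0 by eventually_elim (use below rt t in auto)
  qed (simp add: set_integrable_def)
  moreover have "(LINT x:{r..m}|lebesgue. v m * k x) \<le> (LINT x:{r..m}|lebesgue. k x * v x)"
  proof (rule set_integral_mono_AE)
    show "(\<lambda>x. k x * v x) absolutely_integrable_on {r..m}"
      using rs by (intro absolutely_integrable_on_subinterval[OF kv]) auto
    show "AE x\<in>{r..m} in lebesgue. v m * k x \<le> k x * v x"
      using k0 by eventually_elim
        (use m rs mT in \<open>auto simp: mult.commute intro!: mult_left_mono\<close>)
  qed (simp add: krm)
  moreover have "K m = K r + (LINT x:{r..m}|lebesgue. k x)"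
    unfolding K_def using m rs by (intro absolutely_integral_combine km) auto
  moreover have "(LINT x:{s..m}|lebesgue. k x * v x)
      = (LINT x:{s..r}|lebesgue. k x * v x) + (LINT x:{r..m}|lebesgue. k x * v x)"
    using m rs by (intro absolutely_integral_combine kv) auto
  ultimately have "v m * (K m - K r) \<le> v m"
    using ge[OF mT] by simp
  moreover have "K m - K r < 1"
    using \<delta>(2)[OF mT] m(1) t'(2) by (auto simp: dist_real_def)
  ultimately show False
    using mult_strict_left_mono_neg[of "K m - K r" 1 "v m"] vm by simp
qed

text \<open>At a zero \<open>t\<close> of \<open>v\<close> the integral of the nonnegative function \<open>k * v\<close> over \<open>{s..t}\<close> vanishes.
  Since \<open>k\<close> is positive wherever \<open>v\<close> is, this makes \<open>v\<close> zero throughout \<open>{s..t}\<close>, including at \<open>s\<close>.\<close>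

lemma volterra_pos:
  fixes v k :: "real \<Rightarrow> real"
  assumes v: "continuous_on {s..T} v" and k: "k absolutely_integrable_on {s..T}"
    and k0: "AE x in lebesgue. x \<in> {s..T} \<longrightarrow> 0 \<le> k x"
    and kpos: "AE x in lebesgue. x \<in> {s..T} \<longrightarrow> 0 < v x \<longrightarrow> 0 < k x"
    and ge: "\<And>t. t \<in> {s..T} \<Longrightarrow> (LINT x:{s..t}|lebesgue. k x * v x) \<le> v t"
    and vs: "0 < v s" and t: "t \<in> {s..T}"
  shows "0 < v t"
proof (rule ccontr)
  have v0: "0 \<le> v x" if "x \<in> {s..T}" for x
    by (rule volterra_nonneg[OF v k k0 ge that])
  assume "\<not> 0 < v t"
  then have vt: "v t = 0"
    using v0[OF t] by simp
  then have st: "s < t"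
    using vs t by (metis atLeastAtMost_iff order_le_less order_less_irrefl)
  have vt': "continuous_on {s..t} v"
    using t by (intro continuous_on_subset[OF v]) auto
  have kv: "(\<lambda>x. k x * v x) absolutely_integrable_on {s..t}"
    using absolutely_integrable_mult_continuous[OF vt' absolutely_integrable_on_subinterval[OF k]] t
    by (simp add: mult.commute)
  have nn: "AE x in lebesgue. 0 \<le> indicator {s..t} x *\<^sub>R (k x * v x)"
    using k0 by eventually_elim (use v0 t in \<open>auto simp: indicator_def\<close>)
  then have "(LINT x:{s..t}|lebesgue. k x * v x) = 0"
    using ge[OF t] vt unfolding set_lebesgue_integral_def
    by (intro antisym integral_nonneg_AE) auto
  then have "AE x in lebesgue. indicator {s..t} x *\<^sub>R (k x * v x) = 0"
    using nn kv unfolding set_lebesgue_integral_def set_integrable_def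
    by (subst (asm) integral_nonneg_eq_0_iff_AE) auto
  then have "AE x\<in>{s..t} in lebesgue. v x = 0"
    using kpos
  proof eventually_elim
    case (elim x)
    show ?case
    proof
      assume x: "x \<in> {s..t}"
      then have "k x * v x = 0" "0 < v x \<longrightarrow> 0 < k x"
        using elim t by (auto simp: indicator_def)
      then show "v x = 0"
        using v0[of x] x t by auto
    qed
  qed
  moreover have "v absolutely_integrable_on {s..t}"
    by (rule absolutely_integrable_continuous_real[OF vt'])
  ultimately have "(LINT x:{s..t}|lebesgue. v x) = (LINT x:{s..t}|lebesgue. 0)"
    unfolding set_lebesgue_integral_def set_integrable_def
  proof (intro integral_cong_AE)
    assume "AE x in lebesgue. x \<in> {s..t} \<longrightarrow> v x = 0"
    then show "AE x in lebesgue. indicat_real {s..t} x *\<^sub>R v x = indicat_real {s..t} x *\<^sub>R 0"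
      by eventually_elim (auto simp: indicator_def)
  qed auto
  then have "integral {s..t} v = 0"
    using vt' by (simp add: set_lebesgue_integral_eq_integral absolutely_integrable_continuous_real)
  then have "\<forall>x\<in>{s..t}. v x = 0"
    using t by (subst (asm) integral_eq_0_iff[OF vt' st]) (auto intro!: v0)
  then show False
    using vs st by auto
qed

section \<open>Comparison for cubic right-hand sides\<close>

text \<open>Twice the form is the sum of the squares of \<open>x + z\<close>, \<open>x + \<beta>\<close> and \<open>z + \<beta>\<close>; if the last two vanish,
  then \<open>x = z\<close>.\<close>

lemma cubic_quotient_form_nonneg:
  fixes x z \<beta> :: real
  shows "0 \<le> x\<^sup>2 + x * z + z\<^sup>2 + \<beta> * (x + z) + \<beta>\<^sup>2"
    and "x \<noteq> z \<Longrightarrow> 0 < x\<^sup>2 + x * z + z\<^sup>2 + \<beta> * (x + z) + \<beta>\<^sup>2"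
proof -
  define Q where "Q = x\<^sup>2 + x * z + z\<^sup>2 + \<beta> * (x + z) + \<beta>\<^sup>2"
  have Q: "2 * Q = (x + z)\<^sup>2 + ((x + \<beta>)\<^sup>2 + (z + \<beta>)\<^sup>2)"
    by (simp add: Q_def power2_eq_square algebra_simps)
  have "0 \<le> 2 * Q"
    unfolding Q by simp
  then show "0 \<le> x\<^sup>2 + x * z + z\<^sup>2 + \<beta> * (x + z) + \<beta>\<^sup>2"
    unfolding Q_def[symmetric] by simp
  assume "x \<noteq> z"
  then have "x + \<beta> \<noteq> 0 \<or> z + \<beta> \<noteq> 0"
    by auto
  then have "0 < 2 * Q"
    unfolding Q sum_power2_gt_zero_iff[symmetric] by (rule add_nonneg_pos[OF zero_le_power2])
  then show "0 < x\<^sup>2 + x * z + z\<^sup>2 + \<beta> * (x + z) + \<beta>\<^sup>2"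
    unfolding Q_def[symmetric] by simp
qed

text \<open>The comparison principle behind the theorem. For both bounds the difference \<open>x - z\<close> satisfies a
  linear equation of this shape, with \<open>F\<close> being, up to its sign, the defect with which the bound solves the equation.\<close>

lemma cubic_difference_comparison:
  fixes a b c F x z :: "real \<Rightarrow> real" and s :: real
  defines "E \<equiv> \<lambda>t. exp (LINT r:{s..t}|lebesgue. c r - (b r)\<^sup>2 / a r)"
  assumes a: "continuous_on {s..T} a" and b: "continuous_on {s..T} b"
    and c: "continuous_on {s..T} c" and F: "continuous_on {s..T} F"
    and x: "continuous_on {s..T} x" and z: "continuous_on {s..T} z"
    and neg: "AE t in lebesgue. t \<in> {s..T} \<longrightarrow> a t < 0"
    and int: "(\<lambda>t. (b t)\<^sup>2 / a t) absolutely_integrable_on {s..T}"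
    and deriv: "\<And>t. t \<in> {s..T} \<Longrightarrow> ((\<lambda>t. x t - z t) has_real_derivative
        F t - (x t - z t) * (a t * ((x t)\<^sup>2 + x t * z t + (z t)\<^sup>2) + b t * (x t + z t) + c t))
        (at t within {s..T})"
    and ge: "\<And>t. t \<in> {s..T} \<Longrightarrow> 0 \<le> x s - z s + (LINT r:{s..t}|lebesgue. E r * F r)"
    and t: "t \<in> {s..T}"
  shows "z t \<le> x t" and "z s < x s \<Longrightarrow> z t < x t"
proof -
  define p where "p r = c r - (b r)\<^sup>2 / a r" for r
  \<comment> \<open>Continuous approximations of \<open>p\<close>. Subtracting \<open>1 / Suc n\<close> keeps the denominator away from \<open>0\<close>
    and only increases its modulus where \<open>a < 0\<close>, whence the domination by \<open>\<bar>c\<bar> + \<bar>b\<^sup>2 / a\<bar>\<close>; the minimum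
    takes care of the null set on which nothing is known about the sign of \<open>a\<close>.\<close>
  define P where "P n r = c r - (b r)\<^sup>2 / (min (a r) 0 - 1 / real (Suc n))" for n r
  define u where "u r = x r - z r" for r
  define g where "g r = F r - u r * (a r * ((x r)\<^sup>2 + x r * z r + (z r)\<^sup>2) + b r * (x r + z r) + c r)" for r
  define k where "k r = - (a r * ((x r)\<^sup>2 + x r * z r + (z r)\<^sup>2) + b r * (x r + z r) + (b r)\<^sup>2 / a r)" for r
  define v where "v r = E r * u r" for r
  have p_int: "p absolutely_integrable_on {s..T}"
    unfolding p_def by (intro set_integral_diff absolutely_integrable_continuous_real c int)
  have E_cont: "continuous_on {s..T} E"
    unfolding E_def p_def[symmetric]
    by (intro continuous_intros continuous_on_indefinite_absolutely_integral p_int)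
  have u_cont: "continuous_on {s..T} u"
    unfolding u_def by (intro continuous_intros x z)
  have v_cont: "continuous_on {s..T} v"
    unfolding v_def by (intro continuous_intros E_cont u_cont)
  have k_int: "k absolutely_integrable_on {s..T}"
  proof -
    have "(\<lambda>r. - (a r * ((x r)\<^sup>2 + x r * z r + (z r)\<^sup>2) + b r * (x r + z r))) absolutely_integrable_on {s..T}"
      by (intro absolutely_integrable_continuous_real continuous_intros a b x z)
    from set_integral_diff(1)[OF this int] show ?thesis
      by (simp add: k_def[abs_def])
  qed
  have k_eq: "k r = - a r * ((x r)\<^sup>2 + x r * z r + (z r)\<^sup>2 + b r / a r * (x r + z r) + (b r / a r)\<^sup>2)"
    if "a r < 0" for r
    using that by (simp add: k_def power2_eq_square field_simps)
  have k_nonneg: "AE r in lebesgue. r \<in> {s..T} \<longrightarrow> 0 \<le> k r"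
    using neg
  proof eventually_elim
    case (elim r)
    have "0 \<le> k r" if "a r < 0"
      unfolding k_eq[OF that] using that
      by (intro mult_nonneg_nonneg cubic_quotient_form_nonneg) simp
    then show ?case
      using elim by blast
  qed
  have k_pos: "AE r in lebesgue. r \<in> {s..T} \<longrightarrow> 0 < v r \<longrightarrow> 0 < k r"
    using neg
  proof eventually_elim
    case (elim r)
    have "0 < k r" if "a r < 0" "0 < v r"
    proof -
      have "x r \<noteq> z r"
        using that(2) by (auto simp: v_def u_def)
      then show ?thesis
        unfolding k_eq[OF that(1)] using that(1)
        by (intro mult_pos_pos cubic_quotient_form_nonneg) simp_all
    qed
    then show ?case
      using elim by blast
  qed
  have integral_eq: "v r = u s + (LINT y:{s..r}|lebesgue. E y * (g y + p y * u y))"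
    if r: "r \<in> {s..T}" for r
    unfolding v_def E_def p_def[symmetric]
  proof (rule integrating_factor_integral[where P = P and q = "\<lambda>y. \<bar>c y\<bar> + \<bar>(b y)\<^sup>2 / a y\<bar>" and T = T])
    show "continuous_on {s..T} (P n)" for n
    proof -
      have "min y 0 - 1 / real (Suc n) \<noteq> 0" for y :: real
        using min.cobounded2[of y 0] by (smt (verit) of_nat_0_less_iff zero_less_Suc zero_less_divide_1_iff)
      then show ?thesis
        unfolding P_def by (intro continuous_intros a b c) auto
    qed
    show "AE y in lebesgue. y \<in> {s..T} \<longrightarrow> (\<lambda>n. P n y) \<longlonglongrightarrow> p y"
      using neg
    proof eventually_elim
      case (elim y)
      show ?case
      proof
        assume "y \<in> {s..T}"
        then have ay: "a y < 0"
          using elim by simp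
        have "(\<lambda>n. 1 / real (Suc n)) \<longlonglongrightarrow> 0"
          by (rule LIMSEQ_Suc[OF lim_1_over_n])
        then have "(\<lambda>n. P n y) \<longlonglongrightarrow> c y - (b y)\<^sup>2 / (min (a y) 0 - 0)"
          unfolding P_def using ay by (intro tendsto_intros) auto
        then show "(\<lambda>n. P n y) \<longlonglongrightarrow> p y"
          using ay by (simp add: p_def min_def)
      qed
    qed
    show "AE y in lebesgue. y \<in> {s..T} \<longrightarrow> \<bar>P n y\<bar> \<le> \<bar>c y\<bar> + \<bar>(b y)\<^sup>2 / a y\<bar>" for n
      using neg
    proof eventually_elim
      case (elim y)
      show ?case
      proof
        assume "y \<in> {s..T}"
        then have ay: "a y < 0"
          using elim by simp
        have "\<bar>(b y)\<^sup>2 / (min (a y) 0 - 1 / real (Suc n))\<bar> \<le> \<bar>(b y)\<^sup>2 / a y\<bar>"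
        proof -
          have "0 < 1 / real (Suc n)" "min (a y) 0 = a y"
            using ay by auto
          then have "\<bar>a y\<bar> \<le> \<bar>min (a y) 0 - 1 / real (Suc n)\<bar>"
            using ay by linarith
          then show ?thesis
            using ay unfolding abs_divide by (intro frac_le) auto
        qed
        then show "\<bar>P n y\<bar> \<le> \<bar>c y\<bar> + \<bar>(b y)\<^sup>2 / a y\<bar>"
          unfolding P_def by linarith
      qed
    qed
    show "p absolutely_integrable_on {s..T}"
      by (rule p_int)
    show "(\<lambda>y. \<bar>c y\<bar> + \<bar>(b y)\<^sup>2 / a y\<bar>) absolutely_integrable_on {s..T}"
      by (intro set_integral_add set_integrable_abs absolutely_integrable_continuous_real c int)
    show "(u has_real_derivative g y) (at y within {s..T})" if "y \<in> {s..T}" for y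
      using deriv[OF that] unfolding u_def[abs_def] g_def .
    show "continuous_on {s..T} g"
      unfolding g_def by (intro continuous_intros a b c F x z u_cont)
  qed (rule r)
  have volterra: "(LINT y:{s..r}|lebesgue. k y * v y) \<le> v r" if r: "r \<in> {s..T}" for r
  proof -
    have sub: "{s..r} \<subseteq> {s..T}"
      using r by auto
    have split: "E y * (g y + p y * u y) = E y * F y + k y * v y" for y
      by (simp add: g_def p_def k_def v_def algebra_simps)
    have kv: "(\<lambda>y. k y * v y) absolutely_integrable_on {s..r}"
      using absolutely_integrable_mult_continuous[OF v_cont k_int]
      by (intro absolutely_integrable_on_subinterval[OF _ sub]) (simp add: mult.commute)
    have EF: "(\<lambda>y. E y * F y) absolutely_integrable_on {s..r}"
      by (intro absolutely_integrable_continuous_real continuous_intros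
          continuous_on_subset[OF E_cont sub] continuous_on_subset[OF F sub])
    have "v r = u s + (LINT y:{s..r}|lebesgue. E y * F y) + (LINT y:{s..r}|lebesgue. k y * v y)"
      unfolding integral_eq[OF r] split by (simp only: set_integral_add(2)[OF EF kv] add.assoc)
    then show ?thesis
      using ge[OF r] by (simp add: u_def)
  qed
  have E_pos: "0 < E r" for r
    by (simp add: E_def)
  show "z t \<le> x t"
    using volterra_nonneg[OF v_cont k_int k_nonneg volterra t] E_pos[of t]
    by (simp add: v_def u_def zero_le_mult_iff)
  assume "z s < x s"
  then have "0 < v s"
    using E_pos[of s] by (simp add: v_def u_def)
  from volterra_pos[OF v_cont k_int k_nonneg k_pos volterra this t] show "z t < x t"
    using E_pos[of t] by (simp add: v_def u_def zero_less_mult_iff)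
qed

lemma abel_solution_iff:
  "abel_solution a b c d I y \<longleftrightarrow>
    (\<forall>t\<in>I. (y has_real_derivative - (a t * y t ^ 3 + b t * y t ^ 2 + c t * y t + d t)) (at t within I))"
    (is "_ \<longleftrightarrow> (\<forall>t\<in>I. (y has_real_derivative ?f t) _)")
proof
  assume "abel_solution a b c d I y"
  then obtain y' where "\<And>t. t \<in> I \<Longrightarrow> (y has_real_derivative y' t) (at t within I)"
    and "\<And>t. t \<in> I \<Longrightarrow> y' t + a t * y t ^ 3 + b t * y t ^ 2 + c t * y t + d t = 0"
    unfolding abel_solution_def by blast
  moreover from this(2) have "y' t = ?f t" if "t \<in> I" for t
    using that by (smt (verit))
  ultimately show "\<forall>t\<in>I. (y has_real_derivative ?f t) (at t within I)"
    by metis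
next
  assume "\<forall>t\<in>I. (y has_real_derivative ?f t) (at t within I)"
  then show "abel_solution a b c d I y"
    unfolding abel_solution_def by (intro exI[of _ ?f]) simp
qed

lemma abel_solution_subset:
  "abel_solution a b c d I y \<Longrightarrow> J \<subseteq> I \<Longrightarrow> abel_solution a b c d J y"
  unfolding abel_solution_iff by (meson DERIV_subset subsetD)

lemma abel_solution_continuous_on:
  "abel_solution a b c d I y \<Longrightarrow> continuous_on I y"
  unfolding abel_solution_iff by (meson DERIV_continuous continuous_on_eq_continuous_within)

text \<open>A solution \<open>y1\<close> of an equation with other coefficients solves the given one up to a defect; the
  weighted integral of that defect, not its pointwise sign, decides the comparison. With equal
  coefficients the defect vanishes, which yields uniqueness of solutions.\<close>

lemma abel_solution_ge_subsolution:
  fixes a b c d a1 b1 c1 d1 y y1 :: "real \<Rightarrow> real"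
  assumes conts: "continuous_on {s..T} a" "continuous_on {s..T} b"
      "continuous_on {s..T} c" "continuous_on {s..T} d"
      "continuous_on {s..T} a1" "continuous_on {s..T} b1"
      "continuous_on {s..T} c1" "continuous_on {s..T} d1"
    and neg: "AE t in lebesgue. t \<in> {s..T} \<longrightarrow> a t < 0"
    and int: "(\<lambda>t. (b t)\<^sup>2 / a t) absolutely_integrable_on {s..T}"
    and y: "abel_solution a b c d {s..T} y" and y1: "abel_solution a1 b1 c1 d1 {s..T} y1"
    and ge: "\<And>t. t \<in> {s..T} \<Longrightarrow> 0 \<le> y s - y1 s + (LINT \<tau>:{s..t}|lebesgue.
            exp (LINT r:{s..\<tau>}|lebesgue. c r - (b r)\<^sup>2 / a r) *
            ((a1 \<tau> - a \<tau>) * y1 \<tau> ^ 3 + (b1 \<tau> - b \<tau>) * y1 \<tau> ^ 2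
              + (c1 \<tau> - c \<tau>) * y1 \<tau> + d1 \<tau> - d \<tau>))"
    and t: "t \<in> {s..T}"
  shows "y1 t \<le> y t" and "y1 s < y s \<Longrightarrow> y1 t < y t"
proof -
  define F where "F \<tau> = (a1 \<tau> - a \<tau>) * y1 \<tau> ^ 3 + (b1 \<tau> - b \<tau>) * y1 \<tau> ^ 2
              + (c1 \<tau> - c \<tau>) * y1 \<tau> + d1 \<tau> - d \<tau>" for \<tau>
  note yc = abel_solution_continuous_on[OF y] and y1c = abel_solution_continuous_on[OF y1]
  have F: "continuous_on {s..T} F"
    unfolding F_def by (intro continuous_intros conts y1c)
  have deriv: "((\<lambda>t. y t - y1 t) has_real_derivative
        F t - (y t - y1 t) * (a t * ((y t)\<^sup>2 + y t * y1 t + (y1 t)\<^sup>2) + b t * (y t + y1 t) + c t))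
        (at t within {s..T})" if t: "t \<in> {s..T}" for t
  proof -
    have "((\<lambda>t. y t - y1 t) has_real_derivative
        - (a t * y t ^ 3 + b t * y t ^ 2 + c t * y t + d t)
        - - (a1 t * y1 t ^ 3 + b1 t * y1 t ^ 2 + c1 t * y1 t + d1 t)) (at t within {s..T})"
      using y y1 t unfolding abel_solution_iff by (intro DERIV_diff) auto
    then show ?thesis
      by (rule DERIV_cong) (simp add: F_def power2_eq_square power3_eq_cube algebra_simps)
  qed
  note comparison = cubic_difference_comparison[OF conts(1-3) F yc y1c neg int deriv
      ge[unfolded F_def[symmetric]] t]
  show "y1 t \<le> y t" and "y1 s < y s \<Longrightarrow> y1 t < y t"
    by (rule comparison; assumption)+
qed

lemma abel_solution_le_supersolution:
  fixes a b c d a2 b2 c2 d2 y y2 :: "real \<Rightarrow> real"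
  assumes conts: "continuous_on {s..T} a" "continuous_on {s..T} b"
      "continuous_on {s..T} c" "continuous_on {s..T} d"
      "continuous_on {s..T} a2" "continuous_on {s..T} b2"
      "continuous_on {s..T} c2" "continuous_on {s..T} d2"
    and neg: "AE t in lebesgue. t \<in> {s..T} \<longrightarrow> a t < 0"
    and int: "(\<lambda>t. (b t)\<^sup>2 / a t) absolutely_integrable_on {s..T}"
    and y: "abel_solution a b c d {s..T} y" and y2: "abel_solution a2 b2 c2 d2 {s..T} y2"
    and le: "\<And>t. t \<in> {s..T} \<Longrightarrow> y s - y2 s + (LINT \<tau>:{s..t}|lebesgue.
            exp (LINT r:{s..\<tau>}|lebesgue. c r - (b r)\<^sup>2 / a r) *
            ((a2 \<tau> - a \<tau>) * y2 \<tau> ^ 3 + (b2 \<tau> - b \<tau>) * y2 \<tau> ^ 2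
              + (c2 \<tau> - c \<tau>) * y2 \<tau> + d2 \<tau> - d \<tau>)) \<le> 0"
    and t: "t \<in> {s..T}"
  shows "y t \<le> y2 t" and "y s < y2 s \<Longrightarrow> y t < y2 t"
proof -
  define F where "F \<tau> = (a2 \<tau> - a \<tau>) * y2 \<tau> ^ 3 + (b2 \<tau> - b \<tau>) * y2 \<tau> ^ 2
              + (c2 \<tau> - c \<tau>) * y2 \<tau> + d2 \<tau> - d \<tau>" for \<tau>
  note yc = abel_solution_continuous_on[OF y] and y2c = abel_solution_continuous_on[OF y2]
  have F: "continuous_on {s..T} (\<lambda>t. - F t)"
    unfolding F_def by (intro continuous_intros conts y2c)
  have deriv: "((\<lambda>t. y2 t - y t) has_real_derivative
        - F t - (y2 t - y t) * (a t * ((y2 t)\<^sup>2 + y2 t * y t + (y t)\<^sup>2) + b t * (y2 t + y t) + c t))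
        (at t within {s..T})" if t: "t \<in> {s..T}" for t
  proof -
    have "((\<lambda>t. y2 t - y t) has_real_derivative
        - (a2 t * y2 t ^ 3 + b2 t * y2 t ^ 2 + c2 t * y2 t + d2 t)
        - - (a t * y t ^ 3 + b t * y t ^ 2 + c t * y t + d t)) (at t within {s..T})"
      using y y2 t unfolding abel_solution_iff by (intro DERIV_diff) auto
    then show ?thesis
      by (rule DERIV_cong) (simp add: F_def power2_eq_square power3_eq_cube algebra_simps)
  qed
  have ge: "0 \<le> y2 s - y s + (LINT \<tau>:{s..t}|lebesgue.
      exp (LINT r:{s..\<tau>}|lebesgue. c r - (b r)\<^sup>2 / a r) * - F \<tau>)" if "t \<in> {s..T}" for t
    using le[OF that] unfolding F_def[symmetric] by (simp add: set_lebesgue_integral_def)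
  note comparison = cubic_difference_comparison[OF conts(1-3) F y2c yc neg int deriv ge t]
  show "y t \<le> y2 t" and "y s < y2 s \<Longrightarrow> y t < y2 t"
    by (rule comparison; assumption)+
qed

section \<open>Existence of solutions\<close>

text \<open>The Picard operator is a contraction for the weighted norm \<open>sup \<bar>exp (- K * (t - s)) * y t\<bar>\<close> as soon
  as \<open>K\<close> exceeds the Lipschitz constant, so a single application of Banach's fixed point theorem
  covers the whole interval. The weight is absorbed into the unknown: the fixed point \<open>w\<close> below is
  \<open>exp (- K * (t - s)) * y t\<close>. Precomposing with the projection \<open>c\<close> onto \<open>{s..T}\<close> turns functions
  on the interval into bounded continuous functions on the real line, which form a complete space.\<close>

lemma lipschitz_ode_solution:
  fixes f :: "real \<Rightarrow> real \<Rightarrow> real" and y0 :: real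
  assumes sT: "s \<le> T"
    and cont: "continuous_on ({s..T} \<times> UNIV) (\<lambda>(t, x). f t x)"
    and lip: "\<And>t x y. t \<in> {s..T} \<Longrightarrow> \<bar>f t x - f t y\<bar> \<le> L * \<bar>x - y\<bar>"
  obtains y where "y s = y0"
    and "\<And>t. t \<in> {s..T} \<Longrightarrow> (y has_real_derivative f t (y t)) (at t within {s..T})"
proof -
  \<comment> \<open>With \<open>K\<close> twice a positive Lipschitz constant, the contraction factor is \<open>1/2\<close>.\<close>
  define M where "M = max L 1"
  define K where "K = 2 * M"
  have M: "M > 0" and K: "K > 0" and LM: "L \<le> M"
    by (auto simp: M_def K_def)
  define c where "c t = max s (min T t)" for t
  have c: "c t \<in> {s..T}" for t
    using sT by (auto simp: c_def)
  have c_id: "c t = t" if "t \<in> {s..T}" for t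
    using that by (auto simp: c_def)
  have c_cont: "continuous_on UNIV c"
    unfolding c_def by (intro continuous_intros)
  define F where "F w r = f r (exp (K * (r - s)) * apply_bcontfun w r)" for w :: "real \<Rightarrow>\<^sub>C real" and r
  define \<Phi> where "\<Phi> w t = y0 + integral {s..t} (F w)" for w t
  define G where "G w t = exp (- (K * (c t - s))) * \<Phi> w (c t)" for w t
  have F_cont: "continuous_on {s..T} (F w)" for w
  proof -
    have "continuous_on {s..T} (\<lambda>r. (\<lambda>(t, x). f t x) (r, exp (K * (r - s)) * apply_bcontfun w r))"
      by (rule continuous_on_compose2[OF cont]) (auto intro!: continuous_intros)
    then show ?thesis
      by (simp add: F_def[abs_def])
  qed
  have F_int: "F w integrable_on {s..t}" if "t \<in> {s..T}" for w t
    by (rule integrable_continuous_real, rule continuous_on_subset[OF F_cont]) (use that in auto)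
  have \<Phi>_cont: "continuous_on {s..T} (\<Phi> w)" for w
    unfolding \<Phi>_def
    by (intro continuous_intros indefinite_integral_continuous_1 integrable_continuous_real F_cont)
  have G_bcont: "G w \<in> bcontfun" for w
  proof -
    have g: "continuous_on {s..T} (\<lambda>x. exp (- (K * (x - s))) * \<Phi> w x)"
      by (intro continuous_intros \<Phi>_cont)
    have "continuous_on UNIV (G w)"
      unfolding G_def by (rule continuous_on_compose2[OF g c_cont]) (use c in auto)
    moreover have "range (G w) \<subseteq> (\<lambda>x. exp (- (K * (x - s))) * \<Phi> w x) ` {s..T}"
      using c by (auto simp: G_def)
    then have "bounded (range (G w))"
      using compact_imp_bounded[OF compact_continuous_image[OF g]] bounded_subset by blast
    ultimately show ?thesis
      by (simp add: bcontfun_def)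
  qed
  define H where "H w = Bcontfun (G w)" for w
  have H: "apply_bcontfun (H w) = G w" for w
    unfolding H_def by (rule Bcontfun_inverse[OF G_bcont])
  have contr: "dist (H w) (H v) \<le> 1/2 * dist w v" for w v
  proof (rule dist_bound)
    fix t
    let ?\<tau> = "c t" and ?D = "dist w v"
    have int: "((\<lambda>r. M * ?D * exp (K * (r - s))) has_integral
        M * ?D * exp (K * (?\<tau> - s)) / K - M * ?D * exp (K * (s - s)) / K) {s..?\<tau>}"
    proof (rule fundamental_theorem_of_calculus)
      show "s \<le> ?\<tau>"
        using c[of t] by simp
      show "((\<lambda>r. M * ?D * exp (K * (r - s)) / K) has_vector_derivative M * ?D * exp (K * (x - s)))
          (at x within {s..?\<tau>})" for x
        using K unfolding has_real_derivative_iff_has_vector_derivative[symmetric]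
        by (auto intro!: derivative_eq_intros)
    qed
    have "\<bar>integral {s..?\<tau>} (F w) - integral {s..?\<tau>} (F v)\<bar> = norm (integral {s..?\<tau>} (\<lambda>r. F w r - F v r))"
      by (simp add: integral_diff F_int[OF c])
    also have "\<dots> \<le> integral {s..?\<tau>} (\<lambda>r. M * ?D * exp (K * (r - s)))"
    proof (rule integral_norm_bound_integral)
      show "(\<lambda>r. F w r - F v r) integrable_on {s..?\<tau>}"
        by (intro integrable_diff F_int c)
      show "(\<lambda>r. M * ?D * exp (K * (r - s))) integrable_on {s..?\<tau>}"
        using int by blast
      fix r assume r: "r \<in> {s..?\<tau>}"
      then have rT: "r \<in> {s..T}"
        using c[of t] by auto
      have "norm (F w r - F v r) \<le> L * \<bar>exp (K * (r - s)) * w r - exp (K * (r - s)) * v r\<bar>"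
        unfolding F_def real_norm_def by (rule lip[OF rT])
      also have "\<dots> \<le> M * \<bar>exp (K * (r - s)) * w r - exp (K * (r - s)) * v r\<bar>"
        using LM by (rule mult_right_mono) simp
      also have "\<dots> = M * (dist (w r) (v r) * exp (K * (r - s)))"
        by (simp add: dist_real_def abs_mult flip: right_diff_distrib)
      also have "\<dots> \<le> M * (?D * exp (K * (r - s)))"
        using M by (intro mult_left_mono mult_right_mono dist_bounded) auto
      finally show "norm (F w r - F v r) \<le> M * ?D * exp (K * (r - s))"
        by simp
    qed
    also have "\<dots> = M * ?D * exp (K * (?\<tau> - s)) / K - M * ?D * exp (K * (s - s)) / K"
      using int by (rule integral_unique)
    also have "\<dots> \<le> M * ?D * exp (K * (?\<tau> - s)) / K"
      using M K by simp
    also have "\<dots> = ?D / 2 * exp (K * (?\<tau> - s))"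
      using M by (simp add: K_def)
    finally have le: "\<bar>integral {s..?\<tau>} (F w) - integral {s..?\<tau>} (F v)\<bar> \<le> ?D / 2 * exp (K * (?\<tau> - s))" .
    have "dist (H w t) (H v t)
        = exp (- (K * (?\<tau> - s))) * \<bar>integral {s..?\<tau>} (F w) - integral {s..?\<tau>} (F v)\<bar>"
      by (simp add: H G_def \<Phi>_def dist_real_def abs_mult flip: right_diff_distrib)
    also have "\<dots> \<le> exp (- (K * (?\<tau> - s))) * (?D / 2 * exp (K * (?\<tau> - s)))"
      using le by (rule mult_left_mono) simp
    also have "\<dots> = 1/2 * ?D"
      by (simp add: exp_minus)
    finally show "dist (H w t) (H v t) \<le> 1/2 * ?D" .
  qed
  then obtain w where w: "H w = w"
    using banach_fix_type[of "1/2" H] by auto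
  have fix_eq: "exp (K * (t - s)) * w t = \<Phi> w t" if "t \<in> {s..T}" for t
  proof -
    have "w t = exp (- (K * (t - s))) * \<Phi> w t"
      using H[of w] w c_id[OF that] by (simp add: G_def)
    then show ?thesis
      by (simp add: exp_minus)
  qed
  show thesis
  proof
    show "\<Phi> w s = y0"
      by (simp add: \<Phi>_def)
    fix t assume t: "t \<in> {s..T}"
    have "(\<Phi> w has_real_derivative 0 + F w t) (at t within {s..T})"
      unfolding \<Phi>_def
      by (intro DERIV_add DERIV_const integral_has_real_derivative F_cont t)
    then show "(\<Phi> w has_real_derivative f t (\<Phi> w t)) (at t within {s..T})"
      by (simp add: F_def fix_eq[OF t])
  qed
qed

text \<open>Outside the band \<open>{- M..M}\<close> the cubic is replaced by its value at the nearer edge, which makes it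
  globally Lipschitz. The solution of the truncated equation solves the original one as long as it
  stays in the band, and the a priori bound on solutions prevents it from ever reaching the edge.\<close>

lemma abel_solution_exists_of_bound:
  fixes a b c d :: "real \<Rightarrow> real"
  assumes sT: "s \<le> T"
    and a: "continuous_on {s..T} a" and b: "continuous_on {s..T} b"
    and c: "continuous_on {s..T} c" and d: "continuous_on {s..T} d"
    and y0: "\<bar>y0\<bar> < M"
    and bound: "\<And>r y. r \<in> {s..T} \<Longrightarrow> abel_solution a b c d {s..r} y \<Longrightarrow> y s = y0 \<Longrightarrow> \<bar>y r\<bar> < M"
  obtains y where "abel_solution a b c d {s..T} y" and "y s = y0"
proof -
  have M: "0 < M"
    using y0 by linarith
  define \<kappa> where "\<kappa> x = max (- M) (min M x)" for x
  have \<kappa>: "\<bar>\<kappa> x\<bar> \<le> M" "\<bar>\<kappa> x - \<kappa> y\<bar> \<le> \<bar>x - y\<bar>" for x y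
    using M by (auto simp: \<kappa>_def min_def max_def)
  have \<kappa>_id: "\<kappa> x = x" if "\<bar>x\<bar> \<le> M" for x
    using that by (auto simp: \<kappa>_def)
  define f where "f t x = - (a t * \<kappa> x ^ 3 + b t * \<kappa> x ^ 2 + c t * \<kappa> x + d t)" for t x
  have bdd: "\<exists>B. \<forall>t\<in>{s..T}. \<bar>g t\<bar> \<le> B" if "continuous_on {s..T} g" for g :: "real \<Rightarrow> real"
    using compact_imp_bounded[OF compact_continuous_image[OF that]] by (auto simp: bounded_iff)
  obtain A B C where A: "\<And>t. t \<in> {s..T} \<Longrightarrow> \<bar>a t\<bar> \<le> A" and B: "\<And>t. t \<in> {s..T} \<Longrightarrow> \<bar>b t\<bar> \<le> B"
    and C: "\<And>t. t \<in> {s..T} \<Longrightarrow> \<bar>c t\<bar> \<le> C"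
    using bdd[OF a] bdd[OF b] bdd[OF c] by metis
  have \<kappa>_cont: "continuous_on UNIV \<kappa>"
    unfolding \<kappa>_def by (intro continuous_intros)
  have f_cont: "continuous_on ({s..T} \<times> UNIV) (\<lambda>(t, x). f t x)"
    unfolding f_def case_prod_beta
    by (intro continuous_intros continuous_on_compose2[OF a] continuous_on_compose2[OF b]
        continuous_on_compose2[OF c] continuous_on_compose2[OF d] continuous_on_compose2[OF \<kappa>_cont])
       auto
  have f_lip: "\<bar>f t x - f t y\<bar> \<le> (A * (3 * M\<^sup>2) + B * (2 * M) + C) * \<bar>x - y\<bar>"
    if t: "t \<in> {s..T}" for t x y
  proof -
    let ?p = "\<kappa> x" and ?q = "\<kappa> y"
    have "f t x - f t y = (?q - ?p) * (a t * (?p * ?p + ?p * ?q + ?q * ?q) + b t * (?p + ?q) + c t)"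
      by (simp add: f_def power2_eq_square power3_eq_cube algebra_simps)
    then have "\<bar>f t x - f t y\<bar> = \<bar>?q - ?p\<bar> * \<bar>a t * (?p * ?p + ?p * ?q + ?q * ?q) + b t * (?p + ?q) + c t\<bar>"
      by (simp add: abs_mult)
    also have "\<dots> \<le> \<bar>x - y\<bar> * (A * (3 * M\<^sup>2) + B * (2 * M) + C)"
    proof (rule mult_mono)
      have "\<bar>?p * ?p\<bar> \<le> M * M" "\<bar>?p * ?q\<bar> \<le> M * M" "\<bar>?q * ?q\<bar> \<le> M * M"
        unfolding abs_mult by (intro mult_mono \<kappa>(1); use M in simp)+
      then have "\<bar>?p * ?p + ?p * ?q + ?q * ?q\<bar> \<le> 3 * M\<^sup>2"
        unfolding power2_eq_square by linarith
      then have 1: "\<bar>a t * (?p * ?p + ?p * ?q + ?q * ?q)\<bar> \<le> A * (3 * M\<^sup>2)"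
        unfolding abs_mult using A[OF t] by (intro mult_mono) auto
      have "\<bar>?p + ?q\<bar> \<le> 2 * M"
        using \<kappa>(1)[of x] \<kappa>(1)[of y] by linarith
      then have 2: "\<bar>b t * (?p + ?q)\<bar> \<le> B * (2 * M)"
        unfolding abs_mult using B[OF t] by (intro mult_mono) auto
      show "\<bar>a t * (?p * ?p + ?p * ?q + ?q * ?q) + b t * (?p + ?q) + c t\<bar> \<le> A * (3 * M\<^sup>2) + B * (2 * M) + C"
        using 1 2 C[OF t] by linarith
      show "\<bar>?q - ?p\<bar> \<le> \<bar>x - y\<bar>"
        using \<kappa>(2)[of y x] by (simp add: abs_minus_commute)
    qed auto
    finally show ?thesis
      by (simp add: mult.commute)
  qed
  obtain y where ys: "y s = y0"
    and y: "\<And>t. t \<in> {s..T} \<Longrightarrow> (y has_real_derivative f t (y t)) (at t within {s..T})"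
    using lipschitz_ode_solution[OF sT f_cont f_lip, of y0] by metis
  have sol: "abel_solution a b c d {s..r} y" if r: "r \<le> T" and le: "\<And>t. t \<in> {s..r} \<Longrightarrow> \<bar>y t\<bar> \<le> M" for r
    unfolding abel_solution_iff
  proof
    fix t assume t: "t \<in> {s..r}"
    then have "(y has_real_derivative f t (y t)) (at t within {s..r})"
      using r by (intro DERIV_subset[OF y]) auto
    then show "(y has_real_derivative - (a t * y t ^ 3 + b t * (y t)\<^sup>2 + c t * y t + d t)) (at t within {s..r})"
      by (simp add: f_def \<kappa>_id[OF le[OF t]])
  qed
  have lt: "\<bar>y t\<bar> < M" if "t \<in> {s..T}" for t
  proof (rule ccontr)
    assume "\<not> \<bar>y t\<bar> < M"
    \<comment> \<open>At the first time \<open>r\<close> at which \<open>\<bar>y\<bar>\<close> reaches \<open>M\<close>, the function \<open>y\<close> still solves the original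
      equation on \<open>{s..r}\<close>, so the a priori bound applies at \<open>r\<close>.\<close>
    define S where "S = {s..T} \<inter> (\<lambda>x. \<bar>y x\<bar>) -` {M..}"
    have yc: "continuous_on {s..T} (\<lambda>x. \<bar>y x\<bar>)"
      using y by (intro continuous_intros) (meson DERIV_continuous continuous_on_eq_continuous_within)
    have "closed S"
      unfolding S_def by (rule continuous_closed_preimage[OF yc]) auto
    then have "compact S"
      unfolding compact_eq_bounded_closed by (auto simp: S_def intro: bounded_subset[of "{s..T}"])
    moreover have "t \<in> S"
      using that \<open>\<not> \<bar>y t\<bar> < M\<close> by (auto simp: S_def)
    ultimately obtain r where r: "r \<in> S" "\<And>x. x \<in> S \<Longrightarrow> r \<le> x"
      using compact_attains_inf[of S] by auto
    have before: "\<bar>y x\<bar> < M" if "x \<in> {s..<r}" for x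
      using r(1) r(2)[of x] that by (force simp: S_def)
    have "s < r"
      using r(1) ys y0 by (cases "s = r") (auto simp: S_def)
    have "\<bar>y r\<bar> \<le> M"
    proof (rule tendsto_upperbound)
      have "continuous (at r within {s..T}) (\<lambda>x. \<bar>y x\<bar>)"
        using yc r(1) by (simp add: S_def continuous_on_eq_continuous_within)
      then have "((\<lambda>x. \<bar>y x\<bar>) \<longlongrightarrow> \<bar>y r\<bar>) (at r within {s..T})"
        by (simp add: continuous_within)
      then show "((\<lambda>x. \<bar>y x\<bar>) \<longlongrightarrow> \<bar>y r\<bar>) (at r within {s..<r})"
        by (rule tendsto_within_subset) (use r(1) in \<open>auto simp: S_def\<close>)
      show "\<forall>\<^sub>F x in at r within {s..<r}. \<bar>y x\<bar> \<le> M"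
        using before by (auto simp: eventually_at_filter intro!: always_eventually less_imp_le)
      show "at r within {s..<r} \<noteq> bot"
        using \<open>s < r\<close> by (simp add: trivial_limit_within islimpt_Ico)
    qed
    then have "abel_solution a b c d {s..r} y"
      using before r(1) by (intro sol) (auto simp: S_def less_le intro: less_imp_le)
    then have "\<bar>y r\<bar> < M"
      using r(1) ys by (intro bound) (auto simp: S_def)
    then show False
      using r(1) by (simp add: S_def)
  qed
  show thesis
    using sol[of T] lt ys by (intro that[of y]) (auto intro: less_imp_le)
qed

lemma half_open_subinterval:
  "T \<in> half_open t0 \<tau>0 \<Longrightarrow> {t0..T} \<subseteq> half_open t0 \<tau>0"
  by (auto simp: half_open_def intro: le_less_trans[of "ereal _" "ereal T" \<tau>0])

text \<open>The value at \<open>t\<close> of the solution on \<open>{t0..t}\<close> defines the global solution. Near each \<open>t\<close> it agrees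
  with the solution on \<open>{t0..T}\<close> for some \<open>T\<close> strictly beyond \<open>t\<close>, and so inherits its derivative.\<close>

lemma abel_solution_half_open_glue:
  fixes a b c d :: "real \<Rightarrow> real"
  assumes ex: "\<And>T. T \<in> half_open t0 \<tau>0 \<Longrightarrow> \<exists>y. abel_solution a b c d {t0..T} y \<and> y t0 = y0"
    and uniq: "\<And>T y z. T \<in> half_open t0 \<tau>0 \<Longrightarrow> abel_solution a b c d {t0..T} y \<Longrightarrow>
      abel_solution a b c d {t0..T} z \<Longrightarrow> y t0 = z t0 \<Longrightarrow> y T = z T"
    and \<tau>0: "ereal t0 < \<tau>0"
  shows "\<exists>y. abel_solution a b c d (half_open t0 \<tau>0) y \<and> y t0 = y0"
proof -
  let ?I = "half_open t0 \<tau>0"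
  obtain Y where Y: "\<And>T. T \<in> ?I \<Longrightarrow> abel_solution a b c d {t0..T} (Y T)"
    and Y0: "\<And>T. T \<in> ?I \<Longrightarrow> Y T t0 = y0"
    using ex by metis
  define y where "y t = Y t t" for t
  have y_eq: "y t = Y T t" if "T \<in> ?I" "t \<in> {t0..T}" for t T
  proof -
    have t: "t \<in> ?I"
      using half_open_subinterval[OF that(1)] that(2) by auto
    have "abel_solution a b c d {t0..t} (Y T)"
      using that(2) by (intro abel_solution_subset[OF Y[OF that(1)]]) auto
    then show ?thesis
      unfolding y_def by (rule uniq[OF t Y[OF t]]) (simp add: Y0 t that(1))
  qed
  have "abel_solution a b c d ?I y"
    unfolding abel_solution_iff
  proof
    fix t assume t: "t \<in> ?I"
    then obtain T where T: "ereal t < ereal T" "ereal T < \<tau>0"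
      using ereal_dense2[of "ereal t" \<tau>0] by (auto simp: half_open_def)
    then have TI: "T \<in> ?I"
      using t by (auto simp: half_open_def)
    have tT: "t \<in> {t0..T}"
      using t T by (auto simp: half_open_def)
    have eq: "at t within ?I = at t within {t0..T}"
    proof (rule at_within_nhd[where S = "{..<T}"])
      show "?I \<inter> {..<T} - {t} = {t0..T} \<inter> {..<T} - {t}"
        using half_open_subinterval[OF TI] by (auto simp: half_open_def)
    qed (use T in auto)
    have "(Y T has_real_derivative - (a t * Y T t ^ 3 + b t * (Y T t)\<^sup>2 + c t * Y T t + d t))
        (at t within {t0..T})"
      using Y[OF TI] tT by (auto simp: abel_solution_iff)
    then show "(y has_real_derivative - (a t * y t ^ 3 + b t * (y t)\<^sup>2 + c t * y t + d t)) (at t within ?I)"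
      unfolding eq has_field_derivative_def y_eq[OF TI tT]
      by (rule has_derivative_transform[rotated 2]) (use y_eq[OF TI] tT in auto)
  qed
  moreover have "y t0 = y0"
    using \<tau>0 by (simp add: y_def Y0 half_open_def)
  ultimately show ?thesis
    by blast
qed

section \<open>Comparison and existence between a sub- and a supersolution\<close>

theorem theorem3p3:
  fixes t0 :: real and \<tau>0 :: ereal
    and a b c d a1 b1 c1 d1 a2 b2 c2 d2 y1 y2 :: "real \<Rightarrow> real"
    and \<gamma>1 \<gamma>2 :: real
  assumes "ereal t0 < \<tau>0"
    and "continuous_on (half_open t0 \<tau>0) a" and "continuous_on (half_open t0 \<tau>0) b"
    and "continuous_on (half_open t0 \<tau>0) c" and "continuous_on (half_open t0 \<tau>0) d"
    and "continuous_on (half_open t0 \<tau>0) a1" and "continuous_on (half_open t0 \<tau>0) b1"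
    and "continuous_on (half_open t0 \<tau>0) c1" and "continuous_on (half_open t0 \<tau>0) d1"
    and "continuous_on (half_open t0 \<tau>0) a2" and "continuous_on (half_open t0 \<tau>0) b2"
    and "continuous_on (half_open t0 \<tau>0) c2" and "continuous_on (half_open t0 \<tau>0) d2"
    and "abel_solution a1 b1 c1 d1 (half_open t0 \<tau>0) y1"
    and "abel_solution a2 b2 c2 d2 (half_open t0 \<tau>0) y2"
    and "y1 t0 \<le> y2 t0"
    and "AE t in lebesgue. t \<in> half_open t0 \<tau>0 \<longrightarrow> a t < 0"
    and "\<And>t1. t0 < t1 \<Longrightarrow> ereal t1 < \<tau>0 \<Longrightarrow>
          set_integrable lebesgue {t0..t1} (\<lambda>t. (b t)\<^sup>2 / a t)"
    and "\<gamma>1 \<in> {y1 t0..y2 t0}"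
    and "\<And>t. t \<in> half_open t0 \<tau>0 \<Longrightarrow>
          \<gamma>1 - y1 t0 +
          (LINT \<tau>:{t0..t}|lebesgue.
            exp (LINT s:{t0..\<tau>}|lebesgue. c s - (b s)\<^sup>2 / a s) *
            ((a1 \<tau> - a \<tau>) * y1 \<tau> ^ 3 + (b1 \<tau> - b \<tau>) * y1 \<tau> ^ 2
              + (c1 \<tau> - c \<tau>) * y1 \<tau> + d1 \<tau> - d \<tau>)) \<ge> 0"
    and "\<gamma>2 \<in> {\<gamma>1..y2 t0}"
    and "\<And>t. t \<in> half_open t0 \<tau>0 \<Longrightarrow>
          \<gamma>2 - y2 t0 +
          (LINT \<tau>:{t0..t}|lebesgue.
            exp (LINT s:{t0..\<tau>}|lebesgue. c s - (b s)\<^sup>2 / a s) *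
            ((a2 \<tau> - a \<tau>) * y2 \<tau> ^ 3 + (b2 \<tau> - b \<tau>) * y2 \<tau> ^ 2
              + (c2 \<tau> - c \<tau>) * y2 \<tau> + d2 \<tau> - d \<tau>)) \<le> 0"
  shows "\<forall>y0\<in>{\<gamma>1..\<gamma>2}.
          abel_exists_on a b c d (half_open t0 \<tau>0) t0 y0 \<and>
          (\<forall>y. abel_solution a b c d (half_open t0 \<tau>0) y \<and> y t0 = y0 \<longrightarrow>
            (\<forall>t\<in>half_open t0 \<tau>0. y1 t \<le> y t \<and> y t \<le> y2 t) \<and>
            (y1 t0 < y t0 \<longrightarrow> (\<forall>t\<in>half_open t0 \<tau>0. y1 t < y t)) \<and>
            (y t0 < y2 t0 \<longrightarrow> (\<forall>t\<in>half_open t0 \<tau>0. y t < y2 t)))"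
proof -
  let ?I = "half_open t0 \<tau>0"
  note \<tau>0 = assms(1) and conts = assms(2-13) and y1 = assms(14) and y2 = assms(15)
    and neg = assms(17) and int = assms(18) and \<gamma>1 = assms(19) and below = assms(20)
    and \<gamma>2 = assms(21) and above = assms(22)
  have sub: "{t0..T} \<subseteq> ?I" if "T \<in> ?I" for T
    using that by (rule half_open_subinterval)
  have cont: "continuous_on {t0..T} g" if "T \<in> ?I" "continuous_on ?I g" for T and g :: "real \<Rightarrow> real"
    using that(2) sub[OF that(1)] by (rule continuous_on_subset)
  have negT: "AE t in lebesgue. t \<in> {t0..T} \<longrightarrow> a t < 0" if "T \<in> ?I" for T
    using neg by eventually_elim (use sub[OF that] in auto)
  have intT: "(\<lambda>t. (b t)\<^sup>2 / a t) absolutely_integrable_on {t0..T}" if "T \<in> ?I" for T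
  proof (cases "t0 < T")
    case True
    then show ?thesis
      using that by (intro int) (auto simp: half_open_def)
  next
    case False
    then have "negligible {t0..T}"
      by (intro negligible_subset[OF negligible_sing, of _ t0]) auto
    then show ?thesis
      by (rule absolutely_integrable_negligible)
  qed
  have unique: "y T = z T"
    if T: "T \<in> ?I" and y: "abel_solution a b c d {t0..T} y" and z: "abel_solution a b c d {t0..T} z"
      and eq: "y t0 = z t0" for T y z
  proof -
    have le: "y T \<le> z T"
      if y: "abel_solution a b c d {t0..T} y" and z: "abel_solution a b c d {t0..T} z"
        and eq: "y t0 = z t0" for y z
      by (rule abel_solution_ge_subsolution(1)[OF
            conts(1-4)[THEN cont[OF T]] conts(1-4)[THEN cont[OF T]] negT[OF T] intT[OF T] z y])
         (use T eq in \<open>auto simp: half_open_def\<close>)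
    show ?thesis
      using le[OF y z eq] le[OF z y eq[symmetric]] by (rule antisym)
  qed
  have between: "y1 T \<le> y T \<and> y T \<le> y2 T \<and> (y1 t0 < y t0 \<longrightarrow> y1 T < y T) \<and> (y t0 < y2 t0 \<longrightarrow> y T < y2 T)"
    if T: "T \<in> ?I" and y: "abel_solution a b c d {t0..T} y" and y0: "y t0 \<in> {\<gamma>1..\<gamma>2}" for T y
  proof -
    have TT: "T \<in> {t0..T}"
      using T by (simp add: half_open_def)
    note lower = abel_solution_ge_subsolution[OF conts(1-8)[THEN cont[OF T]] negT[OF T] intT[OF T]
        y abel_solution_subset[OF y1 sub[OF T]] _ TT]
      and upper = abel_solution_le_supersolution[OF conts(1-4)[THEN cont[OF T]]
        conts(9-12)[THEN cont[OF T]] negT[OF T] intT[OF T]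
        y abel_solution_subset[OF y2 sub[OF T]] _ TT]
    have ge: "0 \<le> y t0 - y1 t0 + (LINT \<tau>:{t0..t}|lebesgue.
            exp (LINT s:{t0..\<tau>}|lebesgue. c s - (b s)\<^sup>2 / a s) *
            ((a1 \<tau> - a \<tau>) * y1 \<tau> ^ 3 + (b1 \<tau> - b \<tau>) * y1 \<tau> ^ 2
              + (c1 \<tau> - c \<tau>) * y1 \<tau> + d1 \<tau> - d \<tau>))" if "t \<in> {t0..T}" for t
    proof -
      have "t \<in> ?I" using sub[OF T] that by auto
      from below[OF this] show ?thesis using y0 by simp
    qed
    have le: "y t0 - y2 t0 + (LINT \<tau>:{t0..t}|lebesgue.
            exp (LINT s:{t0..\<tau>}|lebesgue. c s - (b s)\<^sup>2 / a s) *
            ((a2 \<tau> - a \<tau>) * y2 \<tau> ^ 3 + (b2 \<tau> - b \<tau>) * y2 \<tau> ^ 2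
              + (c2 \<tau> - c \<tau>) * y2 \<tau> + d2 \<tau> - d \<tau>)) \<le> 0" if "t \<in> {t0..T}" for t
    proof -
      have "t \<in> ?I" using sub[OF T] that by auto
      from above[OF this] show ?thesis using y0 by simp
    qed
    show ?thesis
      using lower[OF ge] upper[OF le] by blast
  qed
  show ?thesis
  proof (intro ballI conjI allI impI)
    fix y0 assume y0: "y0 \<in> {\<gamma>1..\<gamma>2}"
    have exT: "\<exists>y. abel_solution a b c d {t0..T} y \<and> y t0 = y0" if T: "T \<in> ?I" for T
    proof -
      have "\<exists>B. \<forall>t\<in>{t0..T}. \<bar>g t\<bar> \<le> B" if "continuous_on {t0..T} g" for g :: "real \<Rightarrow> real"
        using compact_imp_bounded[OF compact_continuous_image[OF that]] by (auto simp: bounded_iff)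
      then obtain B1 B2 where B: "\<forall>t\<in>{t0..T}. \<bar>y1 t\<bar> \<le> B1" "\<forall>t\<in>{t0..T}. \<bar>y2 t\<bar> \<le> B2"
        using y1 y2 by (metis T abel_solution_continuous_on cont)
      have tT: "t0 \<le> T"
        using T by (simp add: half_open_def)
      \<comment> \<open>One band containing the graphs of \<open>y1\<close> and \<open>y2\<close> over \<open>{t0..T}\<close> in its interior.\<close>
      have M: "\<bar>x\<bar> < B1 + B2 + 1" if "y1 t \<le> x" "x \<le> y2 t" "t \<in> {t0..T}" for x t
        using that B by (force simp: abs_le_iff abs_less_iff)
      show ?thesis
      proof (rule abel_solution_exists_of_bound[OF tT conts(1-4)[THEN cont[OF T]]])
        show "\<bar>y0\<bar> < B1 + B2 + 1"
          using y0 \<gamma>1 \<gamma>2 tT by (intro M[of t0]) auto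
        show "\<bar>y r\<bar> < B1 + B2 + 1"
          if "r \<in> {t0..T}" "abel_solution a b c d {t0..r} y" "y t0 = y0" for r y
          using between[of r y] that sub[OF T] y0 by (intro M[of r]) auto
      qed auto
    qed
    have "\<exists>Y. abel_solution a b c d ?I Y \<and> Y t0 = y0"
    proof (rule abel_solution_half_open_glue[OF exT _ \<tau>0])
      show "y T = z T" if "T \<in> ?I" "abel_solution a b c d {t0..T} y"
        "abel_solution a b c d {t0..T} z" "y t0 = z t0" for T y z
        using that by (rule unique[of T y z])
    qed
    then obtain Y where Y: "abel_solution a b c d ?I Y" "Y t0 = y0"
      by blast
    show "abel_exists_on a b c d ?I t0 y0"
      unfolding abel_exists_on_def
    proof (intro conjI allI impI)
      show "\<exists>y. abel_solution a b c d ?I y \<and> y t0 = y0"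
        using Y by blast
      fix J z
      assume J: "is_interval J \<and> t0 \<in> J \<and> J \<subseteq> ?I \<and> abel_solution a b c d J z \<and> z t0 = y0"
      have "Y t = z t" if t: "t \<in> J" for t
      proof (rule unique[of t Y z])
        show tI: "t \<in> ?I"
          using J t by auto
        show "abel_solution a b c d {t0..t} Y"
          by (rule abel_solution_subset[OF Y(1) sub[OF tI]])
        have "{t0..t} \<subseteq> J"
          using J t by (auto simp: is_interval_1)
        then show "abel_solution a b c d {t0..t} z"
          using J by (blast intro: abel_solution_subset)
        show "Y t0 = z t0"
          using J Y(2) by simp
      qed
      then show "\<exists>y. abel_solution a b c d ?I y \<and> (\<forall>t\<in>J. y t = z t)"
        using Y(1) by blast
    qed
    fix y assume y: "abel_solution a b c d ?I y \<and> y t0 = y0"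
    then have *: "y1 t \<le> y t \<and> y t \<le> y2 t \<and> (y1 t0 < y t0 \<longrightarrow> y1 t < y t) \<and> (y t0 < y2 t0 \<longrightarrow> y t < y2 t)"
      if "t \<in> ?I" for t
      using y0 that abel_solution_subset[OF _ sub[OF that]] by (intro between) auto
    show "y1 t \<le> y t" "y t \<le> y2 t" if "t \<in> ?I" for t
      using *[OF that] by auto
    show "y1 t < y t" if "y1 t0 < y t0" "t \<in> ?I" for t
      using *[OF that(2)] that(1) by auto
    show "y t < y2 t" if "y t0 < y2 t0" "t \<in> ?I" for t
      using *[OF that(2)] that(1) by auto
  qed
qed

end
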